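(* Let $h\ge 0$ be an integer, let $H\in\mathbb{C}^{2^h}$ be a unit-length vector, let $U\in\mathbb{C}^{2^{h+1}\times 2^{h+1}}$ be a unitary matrix, and let $L:\{0,1\}^{h+1}\to\{0,1\}$ be an arbitrary logical circuit with $h+1$ inputs. For a qubit $D_k\in\mathbb{C}^2$ let $D_{k+1}=L(U\cdot D_kH)$ be the resulting qubit. Suppose that the overall transformation $D_k\mapsto D_{k+1}$ has a magnitude fixed point at $[1,0]^t$. Then $d_{k+1}\ge d_k$ for every qubit $D_k$, where $d_k=P(D_k=0)$ and $d_{k+1}=P(D_{k+1}=0)$.
   Context: A qubit $Q$ is a vector $[q_0,q_1]^t\in\mathbb{C}^2$ with $|q_0|^2+|q_1|^2=1$, and $P(Q=0)=|q_0|^2$, $P(Q=1)=|q_1|^2$. $D_kH$ denotes the tensor (Kronecker) product: if $D_k=[a_k,b_k]^t$ then $D_kH$ is the vector of $\mathbb{C}^{2^{h+1}}$ whose first $2^h$ entries are $a_kH$ and whose last $2^h$ entries are $b_kH$. Indices $i\in\{0,\dots,2^{h+1}-1\}$ are identified with their $(h+1)$-bit binary representations; let $F_L$ be the set of $i$ on which $L$ is false ($0$) and $T_L$ the set on which it is true ($1$). The output qubit $D_{k+1}=L(U\cdot D_kH)$ satisfies $P(D_{k+1}=0)=\sum_{i\in F_L}|(U\cdot D_kH)_i|^2$ and $P(D_{k+1}=1)=\sum_{i\in T_L}|(U\cdot D_kH)_i|^2$; only the magnitudes of its entries (the square roots of these probabilities) matter. For $x=[x_0,\dots,x_{n-1}]^t\in\mathbb{C}^n$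 let $\langle x\rangle=[|x_0|,\dots,|x_{n-1}|]^t$. A function $f$ has a magnitude fixed point $x$ (a vector with nonnegative real entries) if $\langle y\rangle=x$ implies $\langle f(y)\rangle=x$ for every $y$ in its domain. Here the domain is the set of qubits. *)

theory Defs
  imports "HOL-Analysis.Analysis" "Jordan_Normal_Form.Schur_Decomposition"
begin

definition unit_length :: "complex vec \<Rightarrow> bool" where
  "unit_length v \<longleftrightarrow> sqrt (\<Sum>i<dim_vec v. (cmod (v $ i))\<^sup>2) = 1"

definition unitary :: "complex mat \<Rightarrow> bool" where
  "unitary U \<longleftrightarrow> square_mat U \<and> inverts_mat U (mat_adjoint U) \<and> inverts_mat (mat_adjoint U) U"

definition qubit :: "complex vec \<Rightarrow> bool" where
  "qubit Q \<longleftrightarrow> Q \<in> carrier_vec 2 \<and> (cmod (Q $ 0))\<^sup>2 + (cmod (Q $ 1))\<^sup>2 = 1"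

(* Probability P(Q = b) of the outcome b, where False stands for 0 and True for 1. *)
definition qubit_prob :: "complex vec \<Rightarrow> bool \<Rightarrow> real" where
  "qubit_prob Q b = (cmod (Q $ (if b then 1 else 0)))\<^sup>2"

definition qubit_tensor :: "complex vec \<Rightarrow> complex vec \<Rightarrow> complex vec" (infixr "\<otimes>\<^sub>q" 70) where
  "D \<otimes>\<^sub>q H = (D $ 0 \<cdot>\<^sub>v H) @\<^sub>v (D $ 1 \<cdot>\<^sub>v H)"

(* The n-bit binary representation of i, most significant bit first. This matches the order of
   the entries of the tensor product: for n = h + 1 the head of the list is the D-bit. *)
definition bits_of_index :: "nat \<Rightarrow> nat \<Rightarrow> bool list" where
  "bits_of_index n i = map (bit i) (rev [0..<n])"

(* A logical circuit with n inputs is a Boolean function on lists; only its values on lists of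
   length n are used. index_set n L False and index_set n L True are the sets F_L and T_L. *)
definition index_set :: "nat \<Rightarrow> (bool list \<Rightarrow> bool) \<Rightarrow> bool \<Rightarrow> nat set" where
  "index_set n L b = {i. i < 2 ^ n \<and> L (bits_of_index n i) = b}"

(* Q is an output qubit L(v). The outcome probabilities determine Q only up to the phases of its
   two entries, so L(v) is a relation between v and Q rather than a function of v. *)
definition circuit_output :: "nat \<Rightarrow> (bool list \<Rightarrow> bool) \<Rightarrow> complex vec \<Rightarrow> complex vec \<Rightarrow> bool" where
  "circuit_output n L v Q \<longleftrightarrow>
     qubit Q \<and> (\<forall>b. qubit_prob Q b = (\<Sum>i\<in>index_set n L b. (cmod (v $ i))\<^sup>2))"

lemma circuit_output_exists:
  assumes "v \<in> carrier_vec (2 ^ n)" and "unit_length v"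
  shows "\<exists>Q. circuit_output n L v Q"
proof -
  define p where "p b = (\<Sum>i\<in>index_set n L b. (cmod (v $ i))\<^sup>2)" for b
  define Q where "Q = vec 2 (\<lambda>j. complex_of_real (sqrt (p (j = 1))))"
  have p0: "p b \<ge> 0" for b
    unfolding p_def by (rule sum_nonneg) simp
  have fin: "finite (index_set n L b)" for b
    unfolding index_set_def by simp
  have un: "index_set n L False \<union> index_set n L True = {..<2 ^ n}"
    unfolding index_set_def by auto
  have "p False + p True = (\<Sum>i<2 ^ n. (cmod (v $ i))\<^sup>2)"
    unfolding p_def un[symmetric]
    by (rule sum.union_disjoint[symmetric, OF fin fin]) (auto simp: index_set_def)
  also have "\<dots> = 1"
    using assms unfolding unit_length_def by auto
  finally have s: "p False + p True = 1" .
  have "qubit Q"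
    using s p0 unfolding qubit_def Q_def by (simp add: real_sqrt_pow2)
  moreover have "qubit_prob Q b = p b" for b
    using p0 unfolding qubit_prob_def Q_def by (cases b) (simp_all add: real_sqrt_pow2)
  ultimately show ?thesis
    unfolding circuit_output_def p_def by blast
qed

definition magnitude :: "complex vec \<Rightarrow> real vec" where
  "magnitude x = map_vec cmod x"

definition has_magnitude_fixed_point ::
    "complex vec set \<Rightarrow> (complex vec \<Rightarrow> complex vec) \<Rightarrow> real vec \<Rightarrow> bool" where
  "has_magnitude_fixed_point S f x \<longleftrightarrow>
     (\<forall>i<dim_vec x. x $ i \<ge> 0) \<and> (\<forall>y\<in>S. magnitude y = x \<longrightarrow> magnitude (f y) = x)"

end

theory Submission
  imports Defs
begin

text \<open>
  Put \<open>v = U \<cdot> e\<^sub>0H\<close> with \<open>e\<^sub>0 = [1,0]\<^sup>t\<close>, and \<open>x = U \<cdot> DH\<close> with \<open>D = [a,b]\<^sup>t\<close>. As \<open>U\<close> preserves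
  inner products, \<open>\<langle>x,v\<rangle> = a\<close>. The fixed point forces \<open>v\<close> to vanish on \<open>T\<^sub>L\<close>, so the
  Cauchy-Schwarz inequality on \<open>F\<^sub>L\<close> alone gives \<open>|a|\<^sup>2 \<le> (\<Sum>i\<in>F\<^sub>L. |x\<^sub>i|\<^sup>2) \<cdot> |v|\<^sup>2\<close>, and
  \<open>|v| = 1\<close>.
\<close>

text \<open>Row \<open>i\<close> of the adjoint is the conjugate of column \<open>i\<close> of
  \<open>A\<close>, and conjugation passes through the bilinear product \<open>\<bullet>\<close>.
  This reduces the adjoint to a transpose, for which \<open>transpose_vec_mult_scalar\<close> moves
  a matrix across \<open>\<bullet>\<close>.\<close>

lemma mat_adjoint_mult_vec:
  fixes A :: "complex mat"
  assumes "A \<in> carrier_mat n m" "z \<in> carrier_vec n"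
  shows "mat_adjoint A *\<^sub>v z = conjugate (transpose_mat A *\<^sub>v conjugate z)"
proof (rule eq_vecI)
  fix i assume "i < dim_vec (conjugate (transpose_mat A *\<^sub>v conjugate z))"
  then have i: "i < m" using assms by simp
  have "conjugate (col A i) \<bullet> z = conjugate (col A i \<bullet> conjugate z)"
    using assms i conjugate_sprod_vec[of "col A i" n "conjugate z"] by simp
  then show "(mat_adjoint A *\<^sub>v z) $ i = conjugate (transpose_mat A *\<^sub>v conjugate z) $ i"
    using assms i unfolding mat_adjoint_def by simp
qed (use assms in \<open>simp add: mat_adjoint_def\<close>)

text \<open>Since \<open>\<bullet>c\<close> conjugates its right argument, moving \<open>U\<close>
  off \<open>x\<close> leaves its transpose acting on the conjugate of \<open>U *\<^sub>v y\<close>.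
  That vector is the conjugate of the adjoint of \<open>U\<close> applied to
  \<open>U *\<^sub>v y\<close>, hence of \<open>y\<close>.\<close>

lemma unitary_preserves_cscalar_prod:
  assumes U: "U \<in> carrier_mat n n" and "unitary U"
    and x: "x \<in> carrier_vec n" and y: "y \<in> carrier_vec n"
  shows "(U *\<^sub>v x) \<bullet>c (U *\<^sub>v y) = x \<bullet>c y"
proof -
  have A: "mat_adjoint U \<in> carrier_mat n n"
    using U by (auto simp: mat_adjoint_def)
  have inv: "mat_adjoint U * U = 1\<^sub>m n"
    using assms A unfolding unitary_def inverts_mat_def by auto
  have Uy: "U *\<^sub>v y \<in> carrier_vec n" using U y by simp
  have "conjugate (transpose_mat U *\<^sub>v conjugate (U *\<^sub>v y)) = mat_adjoint U *\<^sub>v (U *\<^sub>v y)"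
    by (rule mat_adjoint_mult_vec[OF U Uy, symmetric])
  also have "\<dots> = y"
    using assoc_mult_mat_vec[OF A U y] inv y by simp
  finally have eq: "transpose_mat U *\<^sub>v conjugate (U *\<^sub>v y) = conjugate y"
    by (metis conjugate_id)
  \<comment> \<open>The factors are swapped because the transpose rule moves a matrix from the right
    factor to the left one.\<close>
  have "(U *\<^sub>v x) \<bullet>c (U *\<^sub>v y) = conjugate (U *\<^sub>v y) \<bullet> (U *\<^sub>v x)"
    using U x Uy by (intro comm_scalar_prod[of _ n]) auto
  also have "\<dots> = (transpose_mat U *\<^sub>v conjugate (U *\<^sub>v y)) \<bullet> x"
    using transpose_vec_mult_scalar[OF U x, of "conjugate (U *\<^sub>v y)"] Uy by simp
  also have "\<dots> = x \<bullet>c y"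
    unfolding eq using x y by (intro comm_scalar_prod[of _ n]) auto
  finally show ?thesis .
qed

text \<open>Each half of the concatenation contributes a scalar multiple of
  \<open>H \<bullet>c H\<close>. For a unit vector \<open>H\<close> and \<open>E = [1,0]\<close>
  only \<open>D $ 0\<close> survives.\<close>

lemma cscalar_prod_qubit_tensor:
  assumes "H \<in> carrier_vec n"
  shows "(D \<otimes>\<^sub>q H) \<bullet>c (E \<otimes>\<^sub>q H) = (D $ 0 * cnj (E $ 0) + D $ 1 * cnj (E $ 1)) * (H \<bullet>c H)"
proof -
  have c: "conjugate (E \<otimes>\<^sub>q H) =
      (cnj (E $ 0) \<cdot>\<^sub>v conjugate H) @\<^sub>v (cnj (E $ 1) \<cdot>\<^sub>v conjugate H)"
    unfolding qubit_tensor_def by (rule eq_vecI) (auto simp: append_vec_def Let_def)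
  show ?thesis
    unfolding c unfolding qubit_tensor_def using assms
    by (subst scalar_prod_append[of _ n _ n]) (auto simp: algebra_simps)
qed

lemma cscalar_prod_self_complex:
  fixes v :: "complex vec"
  shows "v \<bullet>c v = complex_of_real (\<Sum>i<dim_vec v. (cmod (v $ i))\<^sup>2)"
  by (simp add: scalar_prod_def atLeast0LessThan complex_norm_square del: of_real_power)

text \<open>Where \<open>v\<close> vanishes, the entries of \<open>x\<close> drop out of the
  product, so they need not enter the bound either.\<close>

lemma cscalar_prod_Cauchy_Schwarz_on_support:
  fixes x v :: "complex vec"
  assumes "dim_vec x = n" "dim_vec v = n" "S \<subseteq> {..<n}"
    and zero: "\<And>i. i < n \<Longrightarrow> i \<notin> S \<Longrightarrow> v $ i = 0"
  shows "(cmod (x \<bullet>c v))\<^sup>2 \<le> (\<Sum>i\<in>S. (cmod (x $ i))\<^sup>2) * (\<Sum>i\<in>S. (cmod (v $ i))\<^sup>2)"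
proof -
  have "x \<bullet>c v = (\<Sum>i<n. x $ i * cnj (v $ i))"
    using assms by (simp add: scalar_prod_def atLeast0LessThan)
  also have "\<dots> = (\<Sum>i\<in>S. x $ i * cnj (v $ i))"
    using assms by (intro sum.mono_neutral_right) auto
  finally have "cmod (x \<bullet>c v) \<le> (\<Sum>i\<in>S. cmod (x $ i) * cmod (v $ i))"
    by (simp add: sum_norm_le norm_mult)
  then have "(cmod (x \<bullet>c v))\<^sup>2 \<le> (\<Sum>i\<in>S. cmod (x $ i) * cmod (v $ i))\<^sup>2"
    by (intro power_mono) auto
  also have "\<dots> \<le> (\<Sum>i\<in>S. (cmod (x $ i))\<^sup>2) * (\<Sum>i\<in>S. (cmod (v $ i))\<^sup>2)"
    by (rule Cauchy_Schwarz_ineq_sum)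
  finally show ?thesis .
qed

theorem theorem4:
  fixes h :: nat and H :: "complex vec" and U :: "complex mat"
    and L :: "bool list \<Rightarrow> bool" and T :: "complex vec \<Rightarrow> complex vec"
  assumes "H \<in> carrier_vec (2 ^ h)" and "unit_length H"
    and "U \<in> carrier_mat (2 ^ (h + 1)) (2 ^ (h + 1))" and "unitary U"
    and "\<And>D. qubit D \<Longrightarrow> circuit_output (h + 1) L (U *\<^sub>v (D \<otimes>\<^sub>q H)) (T D)"
    and "has_magnitude_fixed_point {D. qubit D} T (vec_of_list [1, 0])"
  shows "\<forall>D. qubit D \<longrightarrow> qubit_prob (T D) False \<ge> qubit_prob D False"
proof (intro allI impI)
  fix D assume D: "qubit D"
  define n :: nat where "n = 2 ^ (h + 1)"
  define e :: "complex vec" where "e = vec_of_list [1, 0]"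
  define v where "v = U *\<^sub>v (e \<otimes>\<^sub>q H)"
  define x where "x = U *\<^sub>v (D \<otimes>\<^sub>q H)"
  define F where "F = index_set (h + 1) L False"
  have U: "U \<in> carrier_mat n n" using assms(3) by (simp add: n_def)
  have tensor: "E \<otimes>\<^sub>q H \<in> carrier_vec n" for E
    unfolding qubit_tensor_def n_def by (rule carrier_vecI) (use assms(1) in simp)
  have e: "qubit e" and e01: "e $ 0 = 1" "e $ 1 = 0"
    unfolding e_def qubit_def by (simp_all add: carrier_vecI)
  have dim: "dim_vec x = n" "dim_vec v = n" using U by (simp_all add: x_def v_def)
  have "magnitude e = vec_of_list [1, 0]"
    unfolding magnitude_def e_def by (rule eq_vecI) (auto simp: less_Suc_eq)
  \<comment> \<open>This fixes \<open>T e\<close> only up to the phases of its entries, which is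
    enough to determine both outcome probabilities.\<close>
  then have Te: "magnitude (T e) = vec_of_list [1, 0]"
    using assms(6) e unfolding has_magnitude_fixed_point_def by blast
  have out: "circuit_output (h + 1) L v (T e)" "circuit_output (h + 1) L x (T D)"
    unfolding v_def x_def using assms(5) e D by auto
  have "T e \<in> carrier_vec 2"
    using out(1) unfolding circuit_output_def qubit_def by blast
  then have "cmod (T e $ 0) = magnitude (T e) $ 0" "cmod (T e $ 1) = magnitude (T e) $ 1"
    unfolding magnitude_def by auto
  then have Te01: "qubit_prob (T e) False = 1" "qubit_prob (T e) True = 0"
    unfolding qubit_prob_def Te by auto
  have vF: "(\<Sum>i\<in>F. (cmod (v $ i))\<^sup>2) = 1"
    and vT: "(\<Sum>i\<in>index_set (h + 1) L True. (cmod (v $ i))\<^sup>2) = 0"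
    and xF: "qubit_prob (T D) False = (\<Sum>i\<in>F. (cmod (x $ i))\<^sup>2)"
    using out Te01 unfolding circuit_output_def F_def by auto
  \<comment> \<open>An index below \<open>n\<close> outside \<open>F\<close> makes \<open>L\<close>
    true, so its term belongs to the vanishing sum \<open>vT\<close> of nonnegative terms.\<close>
  have v0: "v $ i = 0" if "i < n" "i \<notin> F" for i
  proof -
    have "i \<in> index_set (h + 1) L True"
      using that unfolding F_def n_def index_set_def by auto
    moreover have "finite (index_set (h + 1) L True)"
      unfolding index_set_def by simp
    ultimately show ?thesis
      using vT by (simp add: sum_nonneg_eq_0_iff)
  qed
  have "H \<bullet>c H = 1"
    using assms(2) unfolding cscalar_prod_self_complex unit_length_def by simp
  then have "x \<bullet>c v = D $ 0"
    unfolding x_def v_def unitary_preserves_cscalar_prod[OF U assms(4) tensor tensor]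
      cscalar_prod_qubit_tensor[OF assms(1)] using e01 by simp
  then have "qubit_prob D False = (cmod (x \<bullet>c v))\<^sup>2"
    by (simp add: qubit_prob_def)
  \<comment> \<open>By \<open>xF\<close> the first factor is the new probability of 0, and by
    \<open>vF\<close> the second is 1.\<close>
  also have "\<dots> \<le> (\<Sum>i\<in>F. (cmod (x $ i))\<^sup>2) * (\<Sum>i\<in>F. (cmod (v $ i))\<^sup>2)"
    using dim v0 by (intro cscalar_prod_Cauchy_Schwarz_on_support) (auto simp: F_def n_def index_set_def)
  finally show "qubit_prob (T D) False \<ge> qubit_prob D False"
    unfolding xF vF by simp
qed

end
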